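(* Let $\varphi$ be a quantifier-free $\mathcal{T}$-formula, $\boldsymbol{\alpha}$ a finite set of atoms containing all atoms of $\varphi$, and $\boldsymbol{\beta}$ a finite set of further $\mathcal{T}$-atoms not in $\boldsymbol{\alpha}$. Let $\{C_1,\ldots,C_K\}$ be a set of $\mathcal{T}$-lemmas on $\boldsymbol{\alpha}\cup\boldsymbol{\beta}$ which rules out $P_{\boldsymbol{\alpha}}(\neg\varphi)$, and let $\mathrm{Text}(\varphi)=\varphi\vee\neg\big(\exists\boldsymbol{\beta}.\bigwedge_{l=1}^K C_l\big)$. Then (i) $\mathrm{Text}(\varphi)\equiv_{\mathcal{T}}\varphi$; (ii) $\varphi\models_p\mathrm{Text}(\varphi)$; (iii) $\mathrm{Text}(\varphi)$ is $\mathcal{T}$-extended with respect to $\boldsymbol{\alpha}$.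
   Context: $\mathcal{T}$-formulas are quantifier-free formulas built by Boolean connectives from $\mathcal{T}$-atoms and Boolean atoms. The Boolean abstraction $\mathcal{T}2\mathcal{B}$ maps each atom bijectively to a fresh Boolean variable (homomorphically on formulas) with inverse (refinement) $\mathcal{B}2\mathcal{T}$; $\varphi\models_p\psi$ means $\mathcal{T}2\mathcal{B}(\varphi)\models\mathcal{T}2\mathcal{B}(\psi)$ propositionally, and $\equiv_{\mathcal{B}}$ is mutual $\models_p$. $\equiv_{\mathcal{T}}$ is equivalence modulo $\mathcal{T}$. A $\mathcal{T}$-lemma is a $\mathcal{T}$-valid clause. For a formula $\psi$ over $\boldsymbol{\alpha}\cup\boldsymbol{\beta}$, $\exists\boldsymbol{\beta}.\psi$ denotes $\mathcal{B}2\mathcal{T}(\exists\mathbf{B}.\mathcal{T}2\mathcal{B}(\psi))$ where $\mathbf{B}=\mathcal{T}2\mathcal{B}(\boldsymbol{\beta})$. A total truth assignment on $\boldsymbol{\alpha}$ is a conjunction containing, for each $a\in\boldsymbol{\alpha}$, exactly one of $a,\neg a$. $P_{\boldsymbol{\alpha}}(\psi)$ is the set of $\mathcal{T}$-unsatisfiable total truth assignments $\rho$ on $\boldsymbol{\alpha}$ with $\rho\models_p\psi$. A set $\{C_1,\dots,C_K\}$ of $\mathcal{T}$-lemmas on $\boldsymbol{\alpha}\cup\boldsymbol{\beta}$ rules out a set $\{\rho_1,\dots,\rho_M\}$ of $\mathcal{T}$-unsatisfiable total truth assignments on $\boldsymbol{\alpha}$ iff $\bigvee_{j=1}^M\rho_j\wedge\bigwedge_{l=1}^K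 C_l\equiv_{\mathcal{B}}\bot$. A formula $\psi$ is $\mathcal{T}$-extended with respect to $\boldsymbol{\alpha}$ iff $P_{\boldsymbol{\alpha}}(\neg\psi)=\emptyset$. *)

theory Defs
  imports Main
begin

datatype (atoms: 'a) form =
    Top
  | Bot
  | Atom 'a
  | Neg "'a form"
  | And "'a form" "'a form"
  | Or "'a form" "'a form"
  | Imp "'a form" "'a form"
  | Iff "'a form" "'a form"

primrec eval :: "('a \<Rightarrow> bool) \<Rightarrow> 'a form \<Rightarrow> bool" where
  "eval v Top = True"
| "eval v Bot = False"
| "eval v (Atom a) = v a"
| "eval v (Neg f) = (\<not> eval v f)"
| "eval v (And f g) = (eval v f \<and> eval v g)"
| "eval v (Or f g) = (eval v f \<or> eval v g)"
| "eval v (Imp f g) = (eval v f \<longrightarrow> eval v g)"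
| "eval v (Iff f g) = (eval v f \<longleftrightarrow> eval v g)"

primrec subst :: "('a \<Rightarrow> 'a form) \<Rightarrow> 'a form \<Rightarrow> 'a form" where
  "subst s Top = Top"
| "subst s Bot = Bot"
| "subst s (Atom a) = s a"
| "subst s (Neg f) = Neg (subst s f)"
| "subst s (And f g) = And (subst s f) (subst s g)"
| "subst s (Or f g) = Or (subst s f) (subst s g)"
| "subst s (Imp f g) = Imp (subst s f) (subst s g)"
| "subst s (Iff f g) = Iff (subst s f) (subst s g)"

text \<open>Finite sets of formulas are joined, and finite sets of variables quantified, along an
  arbitrary enumeration. The choice does not affect the meaning, see \<open>eval_conj\<close>, \<open>eval_disj\<close>
  and \<open>eval_exists_bool\<close> below.\<close>

definition enum_list :: "'a set \<Rightarrow> 'a list" where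
  "enum_list A = (SOME xs. set xs = A \<and> distinct xs)"

definition conj :: "'a form set \<Rightarrow> 'a form" where
  "conj F = foldr And (enum_list F) Top"

definition disj :: "'a form set \<Rightarrow> 'a form" where
  "disj F = foldr Or (enum_list F) Bot"

text \<open>Boolean quantification is by Shannon expansion, so its result is again quantifier-free.\<close>

definition shannon :: "'a \<Rightarrow> 'a form \<Rightarrow> 'a form" where
  "shannon x f = Or (subst (Atom(x := Top)) f) (subst (Atom(x := Bot)) f)"

definition exists_bool :: "'a set \<Rightarrow> 'a form \<Rightarrow> 'a form" where
  "exists_bool B f = foldr shannon (enum_list B) f"

lemma set_enum_list: "finite A \<Longrightarrow> set (enum_list A) = A"
  unfolding enum_list_def using finite_distinct_list[of A] by (metis (mono_tags, lifting) someI_ex)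

lemma eval_conj: "finite F \<Longrightarrow> eval v (conj F) \<longleftrightarrow> (\<forall>f\<in>F. eval v f)"
proof -
  have "eval v (foldr And fs Top) \<longleftrightarrow> (\<forall>f\<in>set fs. eval v f)" for fs
    by (induction fs) auto
  then show "finite F \<Longrightarrow> ?thesis" by (simp add: conj_def set_enum_list)
qed

lemma eval_disj: "finite F \<Longrightarrow> eval v (disj F) \<longleftrightarrow> (\<exists>f\<in>F. eval v f)"
proof -
  have "eval v (foldr Or fs Bot) \<longleftrightarrow> (\<exists>f\<in>set fs. eval v f)" for fs
    by (induction fs) auto
  then show "finite F \<Longrightarrow> ?thesis" by (simp add: disj_def set_enum_list)
qed

lemma eval_subst: "eval v (subst s f) = eval (\<lambda>a. eval v (s a)) f"
  by (induction f) auto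

lemma eval_shannon: "eval v (shannon x f) \<longleftrightarrow> (\<exists>b. eval (v(x := b)) f)"
proof -
  have "(\<lambda>a. eval v ((Atom(x := Top)) a)) = v(x := True)"
    "(\<lambda>a. eval v ((Atom(x := Bot)) a)) = v(x := False)" by auto
  then show ?thesis unfolding shannon_def by (simp add: eval_subst ex_bool_eq)
qed

lemma eval_exists_bool:
  assumes "finite B"
  shows "eval v (exists_bool B f) \<longleftrightarrow> (\<exists>w. (\<forall>a. a \<notin> B \<longrightarrow> w a = v a) \<and> eval w f)"
proof -
  have "eval v (foldr shannon xs f) \<longleftrightarrow> (\<exists>w. (\<forall>a. a \<notin> set xs \<longrightarrow> w a = v a) \<and> eval w f)" for xs
  proof (induction xs arbitrary: v)
    case Nil
    have "(\<forall>a. w a = v a) \<longleftrightarrow> w = v" for w by auto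
    then show ?case by simp
  next
    case (Cons x xs)
    show ?case
    proof
      assume "eval v (foldr shannon (x # xs) f)"
      then obtain b w where "\<forall>a. a \<notin> set xs \<longrightarrow> w a = (v(x := b)) a" "eval w f"
        by (auto simp: eval_shannon Cons)
      then show "\<exists>w. (\<forall>a. a \<notin> set (x # xs) \<longrightarrow> w a = v a) \<and> eval w f"
        by (intro exI[of _ w]) auto
    next
      assume "\<exists>w. (\<forall>a. a \<notin> set (x # xs) \<longrightarrow> w a = v a) \<and> eval w f"
      then obtain w where w: "\<forall>a. a \<notin> set (x # xs) \<longrightarrow> w a = v a" "eval w f" by blast
      then have "\<forall>a. a \<notin> set xs \<longrightarrow> w a = (v(x := w x)) a" by auto
      with w(2) show "eval v (foldr shannon (x # xs) f)"
        unfolding foldr.simps o_apply eval_shannon Cons by blast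
    qed
  qed
  then show ?thesis using assms by (simp add: exists_bool_def set_enum_list)
qed

text \<open>A theory enters only through its interpretations (a structure together with values for the
  free theory variables) and the truth values these give to the theory atoms. Neither the shape of
  the atoms nor the collection of interpretations is restricted.\<close>

record ('m, 't) smt_theory =
  interps :: "'m set"
  holds :: "'m \<Rightarrow> 't \<Rightarrow> bool"

datatype ('t, 'b) atom = TAtom 't | BAtom 'b

type_synonym ('t, 'b) tform = "('t, 'b) atom form"

text \<open>The Boolean atoms are not constrained by the theory: they are valued by an arbitrary \<open>b\<close>.\<close>

definition atom_val :: "('m, 't) smt_theory \<Rightarrow> 'm \<Rightarrow> ('b \<Rightarrow> bool) \<Rightarrow> ('t, 'b) atom \<Rightarrow> bool" where
  "atom_val T m b a = (case a of TAtom t \<Rightarrow> holds T m t | BAtom p \<Rightarrow> b p)"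

definition T_sat :: "('m, 't) smt_theory \<Rightarrow> ('t, 'b) tform \<Rightarrow> bool" where
  "T_sat T f \<longleftrightarrow> (\<exists>m\<in>interps T. \<exists>b. eval (atom_val T m b) f)"

definition T_valid :: "('m, 't) smt_theory \<Rightarrow> ('t, 'b) tform \<Rightarrow> bool" where
  "T_valid T f \<longleftrightarrow> (\<forall>m\<in>interps T. \<forall>b. eval (atom_val T m b) f)"

definition T_equiv :: "('m, 't) smt_theory \<Rightarrow> ('t, 'b) tform \<Rightarrow> ('t, 'b) tform \<Rightarrow> bool" where
  "T_equiv T f g \<longleftrightarrow> (\<forall>m\<in>interps T. \<forall>b. eval (atom_val T m b) f = eval (atom_val T m b) g)"

text \<open>The parameter \<open>h\<close> is the bijection from atoms to Boolean variables underlying the Boolean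
  abstraction; as the variables form a type of their own, they are automatically fresh.\<close>

definition T2B :: "(('t, 'b) atom \<Rightarrow> 'v) \<Rightarrow> ('t, 'b) tform \<Rightarrow> 'v form" where
  "T2B h = map_form h"

definition B2T :: "(('t, 'b) atom \<Rightarrow> 'v) \<Rightarrow> 'v form \<Rightarrow> ('t, 'b) tform" where
  "B2T h = map_form (inv h)"

definition entails :: "'a form \<Rightarrow> 'a form \<Rightarrow> bool" where
  "entails f g \<longleftrightarrow> (\<forall>v. eval v f \<longrightarrow> eval v g)"

definition p_entails :: "(('t, 'b) atom \<Rightarrow> 'v) \<Rightarrow> ('t, 'b) tform \<Rightarrow> ('t, 'b) tform \<Rightarrow> bool" where
  "p_entails h f g \<longleftrightarrow> entails (T2B h f) (T2B h g)"

definition B_equiv :: "(('t, 'b) atom \<Rightarrow> 'v) \<Rightarrow> ('t, 'b) tform \<Rightarrow> ('t, 'b) tform \<Rightarrow> bool" where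
  "B_equiv h f g \<longleftrightarrow> p_entails h f g \<and> p_entails h g f"

definition exists_atoms ::
  "(('t, 'b) atom \<Rightarrow> 'v) \<Rightarrow> ('t, 'b) atom set \<Rightarrow> ('t, 'b) tform \<Rightarrow> ('t, 'b) tform" where
  "exists_atoms h \<beta> f = B2T h (exists_bool (h ` \<beta>) (T2B h f))"

definition is_literal :: "'a form \<Rightarrow> bool" where
  "is_literal f \<longleftrightarrow> (\<exists>a. f = Atom a \<or> f = Neg (Atom a))"

inductive is_clause :: "'a form \<Rightarrow> bool" where
  "is_clause Bot"
| "is_literal f \<Longrightarrow> is_clause f"
| "is_clause f \<Longrightarrow> is_clause g \<Longrightarrow> is_clause (Or f g)"

definition T_lemma :: "('m, 't) smt_theory \<Rightarrow> ('t, 'b) tform \<Rightarrow> bool" where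
  "T_lemma T f \<longleftrightarrow> is_clause f \<and> T_valid T f"

text \<open>Conjunctions of literals are taken modulo order and repetition, so a finite \<open>\<alpha>\<close> has only
  finitely many total assignments.\<close>

definition total_assignments :: "'a set \<Rightarrow> 'a form set" where
  "total_assignments \<alpha> = {conj L | L.
     (\<forall>l\<in>L. is_literal l \<and> atoms l \<subseteq> \<alpha>) \<and> (\<forall>a\<in>\<alpha>. (Atom a \<in> L) \<noteq> (Neg (Atom a) \<in> L))}"

definition P_set :: "('m, 't) smt_theory \<Rightarrow> (('t, 'b) atom \<Rightarrow> 'v) \<Rightarrow> ('t, 'b) atom set
    \<Rightarrow> ('t, 'b) tform \<Rightarrow> ('t, 'b) tform set" where
  "P_set T h \<alpha> f = {\<rho> \<in> total_assignments \<alpha>. \<not> T_sat T \<rho> \<and> p_entails h \<rho> f}"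

definition rules_out ::
  "(('t, 'b) atom \<Rightarrow> 'v) \<Rightarrow> ('t, 'b) tform set \<Rightarrow> ('t, 'b) tform set \<Rightarrow> bool" where
  "rules_out h \<C> R \<longleftrightarrow> B_equiv h (And (disj R) (conj \<C>)) Bot"

definition T_extended ::
  "('m, 't) smt_theory \<Rightarrow> (('t, 'b) atom \<Rightarrow> 'v) \<Rightarrow> ('t, 'b) atom set \<Rightarrow> ('t, 'b) tform \<Rightarrow> bool" where
  "T_extended T h \<alpha> f \<longleftrightarrow> P_set T h \<alpha> (Neg f) = {}"

definition Text :: "(('t, 'b) atom \<Rightarrow> 'v) \<Rightarrow> ('t, 'b) atom set \<Rightarrow> ('t, 'b) tform set
    \<Rightarrow> ('t, 'b) tform \<Rightarrow> ('t, 'b) tform" where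
  "Text h \<beta> \<C> f = Or f (Neg (exists_atoms h \<beta> (conj \<C>)))"

end

theory Submission
  imports Defs
begin

text \<open>Every valuation coming from a \<open>T\<close>-interpretation satisfies all lemmas, hence \<open>\<exists>\<beta>. \<And>\<C>\<close>, so the
  added disjunct is \<open>T\<close>-unsatisfiable. If a \<open>T\<close>-unsatisfiable total assignment \<open>\<rho>\<close> on \<open>\<alpha>\<close> entailed
  the negated extension, it would entail \<open>\<not>\<phi>\<close> and \<open>\<exists>\<beta>. \<And>\<C>\<close>; re-valuing \<open>\<beta>\<close>, which does not occur in
  \<open>\<rho>\<close>, would then satisfy \<open>\<rho>\<close> together with all lemmas, although these rule \<open>\<rho>\<close> out.\<close>

lemma eval_map_form: "eval v (map_form h f) = eval (v \<circ> h) f"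
  by (induction f) auto

lemma eval_cong: "(\<And>a. a \<in> atoms f \<Longrightarrow> v a = w a) \<Longrightarrow> eval v f = eval w f"
  by (induction f) auto

text \<open>For injective \<open>h\<close>, every valuation \<open>w\<close> of atoms factors as
  \<open>(w \<circ> inv h) \<circ> h\<close>, so it comes from a valuation of the Boolean variables.
  The abstraction can therefore be dropped from all later arguments.\<close>

lemma p_entails_iff_entails:
  assumes "inj h"
  shows "p_entails h f g \<longleftrightarrow> entails f g"
proof -
  have "w = (w \<circ> inv h) \<circ> h" for w :: "_ \<Rightarrow> bool"
    using assms by (simp add: comp_assoc)
  then show ?thesis
    unfolding p_entails_def entails_def T2B_def eval_map_form by metis
qed

text \<open>The semantics of \<open>exists_bool\<close> is transported along \<open>h\<close>: a
  valuation \<open>u\<close> of the variables corresponds to \<open>u \<circ> h\<close> on atoms,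
  and \<open>w\<close> on atoms to \<open>w \<circ> inv h\<close>.\<close>

lemma eval_exists_atoms:
  assumes "bij h" "finite \<beta>"
  shows "eval v (exists_atoms h \<beta> f) \<longleftrightarrow> (\<exists>w. (\<forall>a. a \<notin> \<beta> \<longrightarrow> w a = v a) \<and> eval w f)"
proof -
  have inj: "inj h" and surj: "surj h"
    using assms(1) by (auto simp: bij_def)
  have "eval v (exists_atoms h \<beta> f) \<longleftrightarrow>
      (\<exists>u. (\<forall>x. x \<notin> h ` \<beta> \<longrightarrow> u x = v (inv h x)) \<and> eval (u \<circ> h) f)"
    using assms(2)
    by (simp add: exists_atoms_def B2T_def T2B_def eval_map_form eval_exists_bool)
  also have "\<dots> \<longleftrightarrow> (\<exists>w. (\<forall>a. a \<notin> \<beta> \<longrightarrow> w a = v a) \<and> eval w f)"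
  proof
    assume "\<exists>u. (\<forall>x. x \<notin> h ` \<beta> \<longrightarrow> u x = v (inv h x)) \<and> eval (u \<circ> h) f"
    then obtain u where u: "\<forall>x. x \<notin> h ` \<beta> \<longrightarrow> u x = v (inv h x)" "eval (u \<circ> h) f"
      by blast
    then have "\<forall>a. a \<notin> \<beta> \<longrightarrow> (u \<circ> h) a = v a"
      using inj by (simp add: inj_image_mem_iff)
    with u(2) show "\<exists>w. (\<forall>a. a \<notin> \<beta> \<longrightarrow> w a = v a) \<and> eval w f"
      by blast
  next
    assume "\<exists>w. (\<forall>a. a \<notin> \<beta> \<longrightarrow> w a = v a) \<and> eval w f"
    then obtain w where w: "\<forall>a. a \<notin> \<beta> \<longrightarrow> w a = v a" "eval w f"
      by blast
    \<comment> \<open>By surjectivity \<open>x = h (inv h x)\<close>, so \<open>inv h x\<close> in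
      \<open>\<beta>\<close> would put \<open>x\<close> into the image.\<close>
    have "inv h x \<notin> \<beta>" if "x \<notin> h ` \<beta>" for x
      using that surj_f_inv_f[OF surj, of x] by (auto simp: image_iff)
    then have "\<forall>x. x \<notin> h ` \<beta> \<longrightarrow> (w \<circ> inv h) x = v (inv h x)"
      using w(1) by simp
    moreover have "eval ((w \<circ> inv h) \<circ> h) f"
      using w(2) inj by (simp add: comp_assoc)
    ultimately show "\<exists>u. (\<forall>x. x \<notin> h ` \<beta> \<longrightarrow> u x = v (inv h x)) \<and> eval (u \<circ> h) f"
      by (intro exI[of _ "w \<circ> inv h"] conjI)
  qed
  finally show ?thesis .
qed

text \<open>Source of all finiteness facts needed for \<open>eval_conj\<close> and
  \<open>eval_disj\<close>: it bounds both the literal set of one total assignment and the number of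
  such assignments.\<close>

lemma finite_literals_over:
  assumes "finite \<alpha>"
  shows "finite {l. is_literal l \<and> atoms l \<subseteq> \<alpha>}"
proof (rule finite_subset)
  show "{l. is_literal l \<and> atoms l \<subseteq> \<alpha>} \<subseteq> Atom ` \<alpha> \<union> (Neg \<circ> Atom) ` \<alpha>"
    by (auto simp: is_literal_def)
  show "finite (Atom ` \<alpha> \<union> (Neg \<circ> Atom) ` \<alpha>)"
    using assms by simp
qed

lemma finite_total_assignments:
  assumes "finite \<alpha>"
  shows "finite (total_assignments \<alpha>)"
proof (rule finite_subset)
  show "total_assignments \<alpha> \<subseteq> conj ` Pow {l. is_literal l \<and> atoms l \<subseteq> \<alpha>}"
    by (auto simp: total_assignments_def)
  show "finite (conj ` Pow {l. is_literal l \<and> atoms l \<subseteq> \<alpha>})"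
    using finite_literals_over[OF assms] by simp
qed

lemma total_assignment_literals:
  assumes "finite \<alpha>" "\<rho> \<in> total_assignments \<alpha>"
  obtains L where "\<rho> = conj L" "finite L" "\<And>l. l \<in> L \<Longrightarrow> is_literal l \<and> atoms l \<subseteq> \<alpha>"
    "\<And>a. a \<in> \<alpha> \<Longrightarrow> (Atom a \<in> L) \<noteq> (Neg (Atom a) \<in> L)"
proof -
  obtain L where L: "\<rho> = conj L" "\<forall>l\<in>L. is_literal l \<and> atoms l \<subseteq> \<alpha>"
    "\<forall>a\<in>\<alpha>. (Atom a \<in> L) \<noteq> (Neg (Atom a) \<in> L)"
    using assms(2) unfolding total_assignments_def by blast
  moreover have "finite L"
    by (rule finite_subset[OF _ finite_literals_over[OF assms(1)]]) (use L(2) in auto)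
  ultimately show ?thesis
    using that by blast
qed

lemma total_assignment_satisfiable:
  assumes "finite \<alpha>" "\<rho> \<in> total_assignments \<alpha>"
  obtains v where "eval v \<rho>"
proof -
  obtain L where L: "\<rho> = conj L" "finite L" "\<And>l. l \<in> L \<Longrightarrow> is_literal l \<and> atoms l \<subseteq> \<alpha>"
    "\<And>a. a \<in> \<alpha> \<Longrightarrow> (Atom a \<in> L) \<noteq> (Neg (Atom a) \<in> L)"
    using total_assignment_literals[OF assms] by blast
  \<comment> \<open>The valuation is read off \<open>L\<close>. A literal
    \<open>Neg (Atom a)\<close> in \<open>L\<close> holds because \<open>L\<close> then omits
    \<open>Atom a\<close>.\<close>
  have "eval (\<lambda>a. Atom a \<in> L) l" if "l \<in> L" for l
    using L(3)[OF that] L(4) that by (auto simp: is_literal_def)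
  then have "eval (\<lambda>a. Atom a \<in> L) \<rho>"
    using L(1,2) by (simp add: eval_conj)
  then show ?thesis
    by (rule that)
qed

lemma eval_total_assignment_cong:
  assumes "finite \<alpha>" "\<rho> \<in> total_assignments \<alpha>" "\<And>a. a \<in> \<alpha> \<Longrightarrow> v a = w a"
  shows "eval v \<rho> = eval w \<rho>"
proof -
  obtain L where L: "\<rho> = conj L" "finite L" "\<And>l. l \<in> L \<Longrightarrow> is_literal l \<and> atoms l \<subseteq> \<alpha>"
    using total_assignment_literals[OF assms(1,2)] by blast
  have "eval v l = eval w l" if "l \<in> L" for l
    using L(3)[OF that] assms(3) by (intro eval_cong) auto
  then show ?thesis
    using L(1,2) by (simp add: eval_conj)
qed

lemma eval_Text:
  assumes "bij h" "finite \<beta>" "finite \<C>"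
  shows "eval v (Text h \<beta> \<C> f) \<longleftrightarrow>
    eval v f \<or> \<not> (\<exists>w. (\<forall>a. a \<notin> \<beta> \<longrightarrow> w a = v a) \<and> (\<forall>C\<in>\<C>. eval w C))"
  using assms by (simp add: Text_def eval_exists_atoms eval_conj)

text \<open>Entailment from \<open>Bot\<close> is vacuous, so only the propositional
  unsatisfiability of the conjunction remains.\<close>

lemma rules_out_iff:
  assumes "inj h" "finite \<C>" "finite R"
  shows "rules_out h \<C> R \<longleftrightarrow> \<not> (\<exists>\<rho>\<in>R. \<exists>v. eval v \<rho> \<and> (\<forall>C\<in>\<C>. eval v C))"
  using assms
  by (auto simp: rules_out_def B_equiv_def p_entails_iff_entails entails_def eval_conj eval_disj)

theorem theorem4p18:
  fixes T :: "('m, 't) smt_theory"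
    and h :: "('t, 'b) atom \<Rightarrow> 'v"
    and \<phi> :: "('t, 'b) tform"
    and \<alpha> \<beta> :: "('t, 'b) atom set"
    and \<C> :: "('t, 'b) tform set"
  assumes "bij h"
    and "finite \<alpha>" and "atoms \<phi> \<subseteq> \<alpha>"
    and "finite \<beta>" and "\<beta> \<subseteq> range TAtom" and "\<alpha> \<inter> \<beta> = {}"
    and "finite \<C>" and "\<And>C. C \<in> \<C> \<Longrightarrow> T_lemma T C \<and> atoms C \<subseteq> \<alpha> \<union> \<beta>"
    and "rules_out h \<C> (P_set T h \<alpha> (Neg \<phi>))"
  shows "T_equiv T (Text h \<beta> \<C> \<phi>) \<phi>
    \<and> p_entails h \<phi> (Text h \<beta> \<C> \<phi>)
    \<and> T_extended T h \<alpha> (Text h \<beta> \<C> \<phi>)"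
proof (intro conjI)
  have inj: "inj h"
    using assms(1) by (rule bij_is_inj)
  note eval_Text = eval_Text[OF assms(1,4,7)]
  show "T_equiv T (Text h \<beta> \<C> \<phi>) \<phi>"
    \<comment> \<open>The valuation \<open>atom_val T m b\<close> satisfies every lemma, so it
      serves itself as the witness \<open>w\<close> in \<open>eval_Text\<close>.\<close>
    using assms(8) unfolding T_equiv_def eval_Text T_lemma_def T_valid_def by blast
  show "p_entails h \<phi> (Text h \<beta> \<C> \<phi>)"
    unfolding p_entails_iff_entails[OF inj] entails_def eval_Text by blast
  show "T_extended T h \<alpha> (Text h \<beta> \<C> \<phi>)"
    unfolding T_extended_def
  proof (rule equals0I)
    fix \<rho>
    assume "\<rho> \<in> P_set T h \<alpha> (Neg (Text h \<beta> \<C> \<phi>))"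
    then have \<rho>: "\<rho> \<in> total_assignments \<alpha>" "\<not> T_sat T \<rho>"
      and ent: "\<And>v. eval v \<rho> \<Longrightarrow> \<not> eval v (Text h \<beta> \<C> \<phi>)"
      by (auto simp: P_set_def p_entails_iff_entails[OF inj] entails_def)
    \<comment> \<open>Falsity of the disjunction under \<open>\<rho>\<close> includes falsity of its
      first disjunct \<open>\<phi>\<close>.\<close>
    have "\<rho> \<in> P_set T h \<alpha> (Neg \<phi>)"
      using \<rho> ent by (auto simp: P_set_def p_entails_iff_entails[OF inj] entails_def eval_Text)
    \<comment> \<open>Being unsatisfiable in \<open>T\<close>, \<open>\<rho>\<close> has no model
      there; a purely propositional one suffices.\<close>
    moreover obtain v where v: "eval v \<rho>"
      using total_assignment_satisfiable[OF assms(2) \<rho>(1)] .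
    then obtain w where w: "\<forall>a. a \<notin> \<beta> \<longrightarrow> w a = v a" "\<forall>C\<in>\<C>. eval w C"
      using ent unfolding eval_Text by blast
    moreover have "eval w \<rho>"
      \<comment> \<open>Disjointness of \<open>\<alpha>\<close> and \<open>\<beta>\<close> makes
        \<open>w\<close> and \<open>v\<close> agree on \<open>\<alpha>\<close>.\<close>
      using eval_total_assignment_cong[OF assms(2) \<rho>(1), of w v] w(1) v assms(6) by blast
    moreover have "finite (P_set T h \<alpha> (Neg \<phi>))"
      using finite_total_assignments[OF assms(2)] by (simp add: P_set_def)
    ultimately show False
      using assms(9) rules_out_iff[OF inj assms(7)] by blast
  qed
qed

end
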